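(* Let $X$ be a normed linear space, let $Y$ be a closed subspace of $X$ and let $x\in X\setminus Y$. Let $\varepsilon,\delta\in[0,1)$ be such that $\varepsilon<(1-\delta)^2$. Then the following are equivalent: (a) $x\perp_\delta^\varepsilon y$ for every $y\in Y$; (b) there exists $f\in X^*$ with $\|f\|=1$ such that $|f(x)|\ge(1-\delta)\|x\|$ and $\|f|_Y\|\le\frac{\varepsilon}{1-\delta}$.
   Context: All normed linear spaces are over $\mathbb{C}$. $X^*$ is the topological dual of $X$, and $\|f|_Y\|$ is the norm of the restriction of $f$ to $Y$, as a functional on $Y$. For $\delta,\varepsilon\in[0,1)$ with $\varepsilon<(1-\delta)^2$ and $x,y\in X$, one writes $x\perp_\delta^\varepsilon y$ if there exists $f\in X^*\setminus\{0\}$ with $|f(x)|\ge(1-\delta)\|f\|\|x\|$ and $|f(y)|\le\frac{\varepsilon}{1-\delta}\|f\|\|y\|$. *)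

theory Defs
  imports "HOL-Analysis.Analysis"
begin

text \<open>The library has normed spaces over the reals only.  A complex normed space is rendered as a
  real normed space together with a complex scalar multiplication that extends the real one.\<close>

class complex_vector = real_vector +
  fixes scaleC :: "complex \<Rightarrow> 'a \<Rightarrow> 'a" (infixr \<open>*\<^sub>C\<close> 75)
  assumes scaleC_add_right: "a *\<^sub>C (x + y) = a *\<^sub>C x + a *\<^sub>C y"
    and scaleC_add_left: "(a + b) *\<^sub>C x = a *\<^sub>C x + b *\<^sub>C x"
    and scaleC_scaleC: "a *\<^sub>C b *\<^sub>C x = (a * b) *\<^sub>C x"
    and scaleC_one: "1 *\<^sub>C x = x"
    and scaleR_scaleC: "r *\<^sub>R x = complex_of_real r *\<^sub>C x"

class complex_normed_vector = complex_vector + real_normed_vector +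
  assumes norm_scaleC: "norm (a *\<^sub>C x) = cmod a * norm x"

global_interpretation complex_vector: vector_space "scaleC :: complex \<Rightarrow> 'a \<Rightarrow> 'a::complex_vector"
  by unfold_locales (rule scaleC_add_right scaleC_add_left scaleC_scaleC scaleC_one)+

instantiation complex :: complex_normed_vector
begin

definition scaleC_complex :: "complex \<Rightarrow> complex \<Rightarrow> complex" where
  "scaleC_complex a x = a * x"

instance
  by standard (simp_all add: scaleC_complex_def algebra_simps scaleR_conv_of_real norm_mult)

end

definition topological_dual :: "('a::complex_normed_vector \<Rightarrow> complex) set" where
  "topological_dual = {f. Vector_Spaces.linear (*\<^sub>C) (*) f \<and> continuous_on UNIV f}"

text \<open>The norm of \<open>f\<close> restricted to \<open>Y\<close>, as a functional on \<open>Y\<close>; this is \<open>onorm\<close> with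
  \<open>Y\<close> in place of \<open>UNIV\<close>.  At \<open>y = 0\<close> the quotient is \<open>0 / 0 = 0\<close>, so \<open>Y = {0}\<close> gives norm \<open>0\<close>.
  The supremum is taken in the reals and is meaningful for \<open>f\<close> bounded on \<open>Y\<close>, in particular
  for \<open>f\<close> in the dual.\<close>

definition onorm_on :: "'a::complex_normed_vector set \<Rightarrow> ('a \<Rightarrow> complex) \<Rightarrow> real" where
  "onorm_on Y f = (SUP y\<in>Y. norm (f y) / norm y)"

lemma onorm_on_UNIV: "onorm_on UNIV f = onorm f"
  by (simp add: onorm_on_def onorm_def)

definition approx_orthogonal ::
    "real \<Rightarrow> real \<Rightarrow> 'a::complex_normed_vector \<Rightarrow> 'a \<Rightarrow> bool" where
  "approx_orthogonal \<delta> \<epsilon> x y \<longleftrightarrow>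
     (\<exists>f\<in>topological_dual - {\<lambda>_. 0}.
        cmod (f x) \<ge> (1 - \<delta>) * onorm f * norm x \<and>
        cmod (f y) \<le> \<epsilon> / (1 - \<delta>) * onorm f * norm y)"

end

theory Submission
  imports Defs
begin

text \<open>
  Write \<open>a = 1 - \<delta>\<close> and \<open>c = \<epsilon> / (1 - \<delta>)\<close>.  Both conditions are equivalent to the inequality
  \<open>a * norm x \<le> norm (x - y) + c * norm y\<close> for all \<open>y \<in> Y\<close>, in which no functional occurs.

  A functional of norm \<open>1\<close> that witnesses \<open>x \<perp> y\<close> gives the inequality at \<open>y\<close>, because
  \<open>norm (x - y) \<ge> |f (x - y)| \<ge> |f x| - |f y|\<close>.  Conversely, the inequality says that the
  constraints \<open>\<phi> \<le> norm\<close>, \<open>\<phi> y \<le> c * norm y\<close> on \<open>Y\<close> and \<open>\<phi> x \<ge> a * norm x\<close> are compatible,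
  in the sense of the theorem of Mazur and Orlicz (\<open>mazur_orlicz\<close>), which therefore provides one real
  linear \<open>\<phi>\<close> that satisfies them for all \<open>y\<close> at once.  Let \<open>f\<close> be the complex functional with real
  part \<open>\<phi>\<close>.  Since \<open>Y\<close> is a complex subspace, the first two constraints are invariant under
  multiplication of the argument by complex numbers of modulus \<open>1\<close> and therefore bound \<open>|f|\<close>
  (\<open>exists_dual_bounded_on_subspace\<close>).

  This functional \<open>f\<close> has norm at most \<open>1\<close>, and dividing it by its norm may spoil the bound on \<open>Y\<close>.
  As \<open>x\<close> has positive distance to the closed subspace \<open>Y\<close>, the same lemma with \<open>c = 0\<close> yields a
  functional \<open>g\<close> that vanishes on \<open>Y\<close> and has \<open>Re (g x) > 0\<close>.  Adding a multiple \<open>t * g\<close> with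
  \<open>t \<ge> 0\<close> leaves \<open>f\<close> unchanged on \<open>Y\<close> and does not decrease \<open>Re (f x)\<close>, while the norm
  of the sum is continuous and unbounded in \<open>t\<close>; so it equals \<open>1\<close> for some \<open>t\<close>.
  The functional obtained in this way witnesses the orthogonality of \<open>x\<close> to every \<open>y \<in> Y\<close>.
\<close>

section \<open>Sublinear functionals and the theorem of Mazur and Orlicz\<close>

definition sublinear :: "('a::real_vector \<Rightarrow> real) \<Rightarrow> bool" where
  "sublinear p \<longleftrightarrow> (\<forall>x y. p (x + y) \<le> p x + p y) \<and> (\<forall>r\<ge>0. \<forall>x. p (r *\<^sub>R x) = r * p x)"

lemma sublinear_add: "sublinear p \<Longrightarrow> p (x + y) \<le> p x + p y"
  by (simp add: sublinear_def)

lemma sublinear_scaleR: "sublinear p \<Longrightarrow> 0 \<le> r \<Longrightarrow> p (r *\<^sub>R x) = r * p x"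
  by (simp add: sublinear_def)

lemma sublinear_0: "sublinear p \<Longrightarrow> p 0 = 0"
  using sublinear_scaleR[of p 0 0] by simp

lemma sublinear_minus: "sublinear p \<Longrightarrow> - p (- x) \<le> p x"
  using sublinear_add[of p x "- x"] by (simp add: sublinear_0)

lemma sublinear_norm: "sublinear (norm :: 'a::real_normed_vector \<Rightarrow> real)"
  by (simp add: sublinear_def norm_triangle_ineq)

lemma sublinearI:
  assumes add: "\<And>x y. p (x + y) \<le> p x + p y" and zero: "p 0 = 0"
    and scale: "\<And>r x. 0 < r \<Longrightarrow> p (r *\<^sub>R x) \<le> r * p x"
  shows "sublinear p"
  unfolding sublinear_def
proof (intro conjI allI impI add)
  fix r :: real and x
  assume "0 \<le> r"
  show "p (r *\<^sub>R x) = r * p x"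
  proof (cases "r = 0")
    case True
    then show ?thesis by (simp add: zero)
  next
    case False
    with \<open>0 \<le> r\<close> have r: "0 < r" by simp
    then have "p x \<le> p (r *\<^sub>R x) / r"
      using scale[of "1 / r" "r *\<^sub>R x"] by (simp add: divide_inverse mult.commute)
    then have "r * p x \<le> p (r *\<^sub>R x)" using r by (simp add: field_simps)
    with scale[OF r, of x] show ?thesis by simp
  qed
qed

text \<open>The infimum of \<open>p (z - y) + s\<close> over \<open>(y, s) \<in> K\<close> is, as a function of \<open>z\<close>, the largest
  sublinear functional below \<open>p\<close> that meets the constraints in \<open>K\<close>; the condition on \<open>K\<close> bounds
  it below by \<open>- p (- z)\<close>.  A constraint is a pair of a vector and a bound, so that sums and
  nonnegative multiples of constraints are again constraints.\<close>

lemma sublinear_below_cone: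
  fixes p :: "'a::real_vector \<Rightarrow> real" and K :: "('a \<times> real) set"
  assumes p: "sublinear p" and K: "convex_cone K"
    and pos: "\<And>y s. (y, s) \<in> K \<Longrightarrow> 0 \<le> p (- y) + s"
  obtains q where "sublinear q" and "q \<le> p" and "\<And>y s. (y, s) \<in> K \<Longrightarrow> q y \<le> s"
proof -
  define h where "h z k = p (z - fst k) + snd k" for z and k :: "'a \<times> real"
  define q where "q z = (INF k\<in>K. h z k)" for z
  have K0: "(0, 0) \<in> K" and Kadd: "\<And>k l. k \<in> K \<Longrightarrow> l \<in> K \<Longrightarrow> k + l \<in> K"
    and Kscale: "\<And>r k. 0 \<le> r \<Longrightarrow> k \<in> K \<Longrightarrow> r *\<^sub>R k \<in> K"
    using K by (auto simp: convex_cone_add convex_cone_scaleR convex_cone_contains_0 zero_prod_def[symmetric])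
  have ne: "K \<noteq> {}" using K0 by auto
  have lower: "- p (- z) \<le> h z k" if "k \<in> K" for z k
  proof -
    have "p (- fst k) \<le> p (z - fst k) + p (- z)"
      using sublinear_add[OF p, of "z - fst k" "- z"] by simp
    with pos[of "fst k" "snd k"] that show ?thesis by (simp add: h_def)
  qed
  have bdd: "bdd_below (h z ` K)" for z
    using lower by (rule bdd_belowI2)
  have q_le: "q z \<le> h z k" if "k \<in> K" for z k
    unfolding q_def by (rule cINF_lower[OF bdd that])
  have q_le_p: "q z \<le> p z" for z using q_le[OF K0, of z] by (simp add: h_def)
  have q_K: "q y \<le> s" if "(y, s) \<in> K" for y s
    using q_le[OF that, of y] by (simp add: h_def sublinear_0[OF p])
  have "sublinear q"
  proof (rule sublinearI)
    fix w z
    have "q (w + z) - h z l \<le> q w" if l: "l \<in> K" for l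
      unfolding q_def[of w]
    proof (rule cINF_greatest[OF ne])
      fix k assume k: "k \<in> K"
      have "h (w + z) (k + l) \<le> h w k + h z l"
        using sublinear_add[OF p, of "w - fst k" "z - fst l"] by (simp add: h_def algebra_simps)
      with q_le[OF Kadd[OF k l], of "w + z"] show "q (w + z) - h z l \<le> h w k" by simp
    qed
    then have "q (w + z) - q w \<le> q z"
      unfolding q_def[of z] by (intro cINF_greatest[OF ne]) (auto simp: algebra_simps)
    then show "q (w + z) \<le> q w + q z" by simp
  next
    have "- p (- 0) \<le> q 0"
      unfolding q_def using lower by (intro cINF_greatest[OF ne]) blast
    with q_le_p[of 0] show "q 0 = 0" by (simp add: sublinear_0[OF p])
  next
    fix r :: real and z
    assume r: "0 < r"
    have "q (r *\<^sub>R z) / r \<le> q z"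
      unfolding q_def[of z]
    proof (rule cINF_greatest[OF ne])
      fix k assume k: "k \<in> K"
      have "h (r *\<^sub>R z) (r *\<^sub>R k) = r * h z k"
        using r sublinear_scaleR[OF p, of r "z - fst k"] by (simp add: h_def algebra_simps)
      then show "q (r *\<^sub>R z) / r \<le> h z k"
        using q_le[OF Kscale[of r, OF _ k], of "r *\<^sub>R z"] r by (simp add: field_simps)
    qed
    then show "q (r *\<^sub>R z) \<le> r * q z" using r by (simp add: field_simps)
  qed
  then show thesis using q_le_p q_K by (intro that) (auto simp: le_fun_def)
qed

text \<open>Functionals below \<open>p\<close> are bounded below by \<open>- p (- z)\<close>, hence the pointwise infimum is finite.
  It is subadditive because the family is a chain.\<close>

lemma sublinear_chain_lower_bound:
  assumes p: "sublinear p" and ne: "C \<noteq> {}"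
    and C: "\<And>q. q \<in> C \<Longrightarrow> sublinear q \<and> q \<le> p"
    and chain: "\<And>q r. q \<in> C \<Longrightarrow> r \<in> C \<Longrightarrow> q \<le> r \<or> r \<le> q"
  shows "sublinear (\<lambda>z. INF q\<in>C. q z)" and "\<And>q. q \<in> C \<Longrightarrow> (\<lambda>z. INF q\<in>C. q z) \<le> q"
proof -
  define m where "m z = (INF q\<in>C. q z)" for z
  have lower: "- p (- z) \<le> q z" if "q \<in> C" for q z
    using sublinear_minus[of q z] C[OF that] by (smt (verit) le_funD)
  have bdd: "bdd_below ((\<lambda>q. q z) ` C)" for z
    using lower by (rule bdd_belowI2)
  have m_le: "m z \<le> q z" if "q \<in> C" for z q
    unfolding m_def by (rule cINF_lower[OF bdd that])
  have "sublinear m"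
  proof (rule sublinearI)
    fix w z
    have "m (w + z) \<le> q w + r z" if q: "q \<in> C" and r: "r \<in> C" for q r
    proof -
      \<comment> \<open>The smaller of \<open>q\<close> and \<open>r\<close> bounds both summands.\<close>
      obtain u where u: "u \<in> C" "u \<le> q" "u \<le> r" using chain[OF q r] q r by blast
      have "u (w + z) \<le> u w + u z" using C[OF u(1)] sublinear_add by blast
      with u m_le[OF u(1), of "w + z"] show ?thesis by (smt (verit) le_funD)
    qed
    then have "m (w + z) - r z \<le> m w" if "r \<in> C" for r
      unfolding m_def[of w] using that by (intro cINF_greatest[OF ne]) (simp add: algebra_simps)
    then have "m (w + z) - m w \<le> m z"
      unfolding m_def[of z] by (intro cINF_greatest[OF ne]) (auto simp: algebra_simps)
    then show "m (w + z) \<le> m w + m z" by simp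
  next
    have "(\<lambda>q. q 0) ` C = {0}" using ne C sublinear_0 by force
    then show "m 0 = 0" by (simp add: m_def)
  next
    fix r :: real and z
    assume r: "0 < r"
    have "m (r *\<^sub>R z) / r \<le> m z"
      unfolding m_def[of z]
    proof (rule cINF_greatest[OF ne])
      fix q assume q: "q \<in> C"
      show "m (r *\<^sub>R z) / r \<le> q z"
        using m_le[OF q, of "r *\<^sub>R z"] r sublinear_scaleR[of q r z] C[OF q] by (simp add: field_simps)
    qed
    then show "m (r *\<^sub>R z) \<le> r * m z" using r by (simp add: field_simps)
  qed
  then show "sublinear (\<lambda>z. INF q\<in>C. q z)" by (simp add: m_def[abs_def])
  show "(\<lambda>z. INF q\<in>C. q z) \<le> q" if "q \<in> C" for q
    using m_le[OF that] by (simp add: le_fun_def m_def)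
qed

text \<open>A sublinear functional \<open>q\<close> can be lowered so that its value at \<open>- v\<close> becomes at most
  \<open>- q v\<close>.  A minimal one is therefore odd, and an odd sublinear functional is linear.\<close>

lemma linear_if_minimal_sublinear:
  assumes q: "sublinear q" and min: "\<And>r. sublinear r \<Longrightarrow> r \<le> q \<Longrightarrow> r = q"
  shows "linear q"
proof -
  have "q (- v) \<le> - q v" for v
  proof -
    define K where "K = (\<lambda>t. (- (t *\<^sub>R v), - (t * q v))) ` {0..}"
    have KI: "(- (t *\<^sub>R v), - (t * q v)) \<in> K" if "0 \<le> t" for t
      using that by (auto simp: K_def)
    have "convex_cone K"
      unfolding convex_cone_iff
    proof (intro conjI ballI allI impI)
      show "0 \<in> K" using KI[of 0] by (simp add: zero_prod_def)
    next
      fix k l assume "k \<in> K" "l \<in> K"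
      then obtain s t where "0 \<le> s" "0 \<le> t" "k = (- (s *\<^sub>R v), - (s * q v))"
        "l = (- (t *\<^sub>R v), - (t * q v))" by (auto simp: K_def)
      then show "k + l \<in> K" using KI[of "s + t"] by (simp add: algebra_simps)
    next
      fix k and r :: real assume "k \<in> K" "0 \<le> r"
      then obtain t where "0 \<le> t" "k = (- (t *\<^sub>R v), - (t * q v))" by (auto simp: K_def)
      with \<open>0 \<le> r\<close> show "r *\<^sub>R k \<in> K" using KI[of "r * t"] by (simp add: mult.assoc)
    qed
    moreover have "0 \<le> q (- y) + s" if "(y, s) \<in> K" for y s
      using that by (auto simp: K_def sublinear_scaleR[OF q])
    ultimately obtain r where "sublinear r" "r \<le> q" and r: "\<And>y s. (y, s) \<in> K \<Longrightarrow> r y \<le> s"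
      using sublinear_below_cone[OF q] by blast
    moreover have "(- v, - q v) \<in> K" using KI[of 1] by simp
    ultimately show ?thesis using min by blast
  qed
  then have odd: "q (- v) = - q v" for v
    using sublinear_minus[OF q, of v] by (smt (verit))
  show ?thesis
  proof (rule linearI)
    fix v w
    have "q v \<le> q (v + w) + q (- w)" using sublinear_add[OF q, of "v + w" "- w"] by simp
    with sublinear_add[OF q, of v w] show "q (v + w) = q v + q w" by (simp add: odd)
  next
    fix t v
    show "q (t *\<^sub>R v) = t *\<^sub>R q v"
      using sublinear_scaleR[OF q, of t v] sublinear_scaleR[OF q, of "- t" v] odd[of "t *\<^sub>R v"]
      by (cases "0 \<le> t") auto
  qed
qed

text \<open>The core of the Hahn--Banach theorem: by Zorn's lemma there is a minimal sublinear functional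
  below \<open>p\<close>, and minimality makes it linear.\<close>

lemma exists_linear_below_sublinear:
  assumes p: "sublinear p"
  obtains \<phi> where "linear \<phi>" and "\<phi> \<le> p"
proof -
  define A where "A = {q. sublinear q \<and> q \<le> p}"
  have "partial_order_on A (relation_of (\<lambda>q r. r \<le> q) A)"
    by (rule partial_order_on_relation_ofI) auto
  then have "\<exists>m\<in>A. \<forall>a\<in>A. a \<le> m \<longrightarrow> a = m"
  proof (rule predicate_Zorn)
    fix C assume "C \<in> Chains (relation_of (\<lambda>q r. r \<le> q) A)"
    then have CA: "\<And>q. q \<in> C \<Longrightarrow> sublinear q \<and> q \<le> p"
      and chain: "\<And>q r. q \<in> C \<Longrightarrow> r \<in> C \<Longrightarrow> q \<le> r \<or> r \<le> q"
      by (auto simp: Chains_def relation_of_def A_def)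
    show "\<exists>u\<in>A. \<forall>a\<in>C. u \<le> a"
    proof (cases "C = {}")
      case True
      then show ?thesis using p by (auto simp: A_def)
    next
      case False
      note lb = sublinear_chain_lower_bound[OF p False CA chain]
      have "(\<lambda>z. INF q\<in>C. q z) \<le> p" using False lb(2) CA by (meson ex_in_conv order_trans)
      with lb show ?thesis by (auto simp: A_def)
    qed
  qed
  then obtain m where m: "m \<in> A" "\<And>a. a \<in> A \<Longrightarrow> a \<le> m \<Longrightarrow> a = m" by blast
  have "linear m"
  proof (rule linear_if_minimal_sublinear)
    show "sublinear m" using m(1) by (simp add: A_def)
    show "r = m" if "sublinear r" "r \<le> m" for r
      using m that by (auto simp: A_def)
  qed
  with m(1) show thesis by (intro that) (auto simp: A_def)
qed

text \<open>The hypothesis on \<open>K\<close> is necessary: \<open>- \<phi> y \<le> p (- y)\<close> and \<open>\<phi> y \<le> s\<close> add up to it.\<close>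

lemma mazur_orlicz:
  fixes p :: "'a::real_vector \<Rightarrow> real"
  assumes "sublinear p" and "convex_cone K" and "\<And>y s. (y, s) \<in> K \<Longrightarrow> 0 \<le> p (- y) + s"
  obtains \<phi> where "linear \<phi>" and "\<phi> \<le> p" and "\<And>y s. (y, s) \<in> K \<Longrightarrow> \<phi> y \<le> s"
proof -
  obtain q where q: "sublinear q" "q \<le> p" "\<And>y s. (y, s) \<in> K \<Longrightarrow> q y \<le> s"
    using sublinear_below_cone[OF assms] by blast
  obtain \<phi> where "linear \<phi>" "\<phi> \<le> q" using exists_linear_below_sublinear[OF q(1)] by blast
  show thesis
  proof (rule that[OF \<open>linear \<phi>\<close>])
    show "\<phi> \<le> p" using \<open>\<phi> \<le> q\<close> q(2) by (rule order_trans)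
    show "\<phi> y \<le> s" if "(y, s) \<in> K" for y s
      using le_funD[OF \<open>\<phi> \<le> q\<close>] q(3)[OF that] by (rule order_trans)
  qed
qed

section \<open>Complex functionals\<close>

lemma complex_linear_iff:
  "Vector_Spaces.linear (*\<^sub>C) (*) (f :: 'a::complex_vector \<Rightarrow> complex) \<longleftrightarrow>
    (\<forall>x y. f (x + y) = f x + f y) \<and> (\<forall>a x. f (a *\<^sub>C x) = a * f x)"
proof -
  have "vector_space ((*) :: complex \<Rightarrow> _)" by unfold_locales (simp_all add: algebra_simps)
  then show ?thesis
    by (auto simp: Vector_Spaces.linear_iff complex_vector.vector_space_axioms)
qed

lemma exists_complex_linear_with_Re:
  fixes \<phi> :: "'a::complex_vector \<Rightarrow> real"
  assumes "linear \<phi>"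
  obtains f where "Vector_Spaces.linear (*\<^sub>C) (*) f" and "\<And>z. Re (f z) = \<phi> z"
proof -
  define f where "f z = Complex (\<phi> z) (- \<phi> (\<i> *\<^sub>C z))" for z
  have scale: "\<phi> (complex_of_real r *\<^sub>C z) = r * \<phi> z" for r z
    using linear_scale[OF assms, of r z] by (simp add: scaleR_scaleC)
  have \<phi>_scaleC: "\<phi> (a *\<^sub>C z) = Re a * \<phi> z + Im a * \<phi> (\<i> *\<^sub>C z)" for a z
  proof -
    have "a *\<^sub>C z = complex_of_real (Re a) *\<^sub>C z + complex_of_real (Im a) *\<^sub>C \<i> *\<^sub>C z"
      by (simp add: scaleC_scaleC mult.commute flip: scaleC_add_left complex_eq)
    then show ?thesis by (simp only: linear_add[OF assms] scale)
  qed
  have "\<phi> (\<i> *\<^sub>C a *\<^sub>C z) = Re a * \<phi> (\<i> *\<^sub>C z) - Im a * \<phi> z" for a z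
    using \<phi>_scaleC[of "\<i> * a" z] by (simp add: scaleC_scaleC)
  then have "f (a *\<^sub>C z) = a * f z" for a z
    using \<phi>_scaleC[of a z] by (simp add: f_def complex_eq_iff)
  moreover have "f (w + z) = f w + f z" for w z
    by (simp add: f_def complex_eq_iff scaleC_add_right linear_add[OF assms])
  ultimately have "Vector_Spaces.linear (*\<^sub>C) (*) f" by (simp add: complex_linear_iff)
  then show thesis by (rule that) (simp add: f_def)
qed

lemma cmod_le_if_Re_rotations_le:
  assumes f: "Vector_Spaces.linear (*\<^sub>C) (*) f"
    and le: "\<And>u. cmod u = 1 \<Longrightarrow> Re (f (u *\<^sub>C z)) \<le> B"
  shows "cmod (f z) \<le> B"
proof (cases "f z = 0")
  case True
  then show ?thesis using le[of 1] f by (simp add: complex_linear_iff)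
next
  case False
  define u where "u = cnj (f z) / cmod (f z)"
  have "cmod u = 1" using False by (simp add: u_def norm_divide)
  moreover have "u * f z = cmod (f z)"
    using False by (simp add: u_def complex_norm_square[symmetric] power2_eq_square mult.commute)
  ultimately show ?thesis using le[of u] f by (simp add: complex_linear_iff)
qed

lemma dual_imp_bounded_linear:
  fixes f :: "'a::complex_normed_vector \<Rightarrow> complex"
  assumes "f \<in> topological_dual"
  shows "bounded_linear f"
proof -
  have f: "f (x + y) = f x + f y" "f (a *\<^sub>C x) = a * f x" for x y a
    using assms by (auto simp: topological_dual_def complex_linear_iff)
  have lin: "linear f"
    by (rule linearI) (simp_all only: f scaleR_scaleC[where ?'a = 'a] scaleR_conv_of_real)
  have "isCont f 0"
    using assms by (simp add: topological_dual_def continuous_on_eq_continuous_at)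
  then obtain d where d: "0 < d" "\<And>z. norm z < d \<Longrightarrow> cmod (f z) < 1"
    unfolding continuous_at_eps_delta by (metis dist_0_norm dist_commute linear_0[OF lin] zero_less_one)
  have "norm (f z) \<le> norm z * (2 / d)" for z
  proof (cases "z = 0")
    case True
    then show ?thesis by (simp add: linear_0[OF lin])
  next
    case False
    define r where "r = d / (2 * norm z)"
    have r: "0 < r" using d(1) False by (simp add: r_def)
    have "norm (r *\<^sub>R z) < d" using d(1) False by (simp add: r_def)
    then have "r * norm (f z) < 1"
      using d(2)[of "r *\<^sub>R z"] r by (simp add: linear_scale[OF lin])
    then show ?thesis using d(1) False by (simp add: r_def field_simps)
  qed
  with lin show ?thesis
    unfolding bounded_linear_def bounded_linear_axioms_def by blast
qed

lemma dual_if_bounded: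
  fixes f :: "'a::complex_normed_vector \<Rightarrow> complex"
  assumes f: "Vector_Spaces.linear (*\<^sub>C) (*) f" and bound: "\<And>z. cmod (f z) \<le> norm z"
  shows "f \<in> topological_dual"
proof -
  have "bounded_linear f"
    using f bound by (intro bounded_linear_intro[where K = 1])
      (simp_all add: complex_linear_iff scaleR_scaleC[where ?'a = 'a] scaleR_conv_of_real)
  with f show ?thesis by (simp add: topological_dual_def linear_continuous_on)
qed

lemma dual_add_scaleR:
  assumes "f \<in> topological_dual" and "g \<in> topological_dual"
  shows "(\<lambda>z. f z + t *\<^sub>R g z) \<in> topological_dual"
  using assms unfolding topological_dual_def complex_linear_iff
  by (auto simp: algebra_simps scaleR_conv_of_real intro!: continuous_intros)

lemma onorm_on_le_iff:
  assumes "f \<in> topological_dual" and "Y \<noteq> {}" and "0 \<le> c"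
  shows "onorm_on Y f \<le> c \<longleftrightarrow> (\<forall>y\<in>Y. cmod (f y) \<le> c * norm y)"
proof -
  have bl: "bounded_linear f" using assms(1) by (rule dual_imp_bounded_linear)
  have "bdd_above ((\<lambda>y. cmod (f y) / norm y) ` Y)"
    by (rule bdd_aboveI2) (rule le_onorm[OF bl])
  then have iff: "onorm_on Y f \<le> c \<longleftrightarrow> (\<forall>y\<in>Y. cmod (f y) / norm y \<le> c)"
    unfolding onorm_on_def using assms(2) by (simp add: cSUP_le_iff)
  have "cmod (f y) / norm y \<le> c \<longleftrightarrow> cmod (f y) \<le> c * norm y" for y
    using assms(3) by (cases "y = 0") (simp_all add: linear_0[OF bounded_linear.linear[OF bl]] field_simps)
  with iff show ?thesis by simp
qed

section \<open>Functionals with a prescribed bound on a subspace\<close>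

text \<open>The bounds on \<open>Y\<close> and the bound \<open>\<phi> (- x) \<le> - b\<close> span the cone of pairs
  \<open>(y - t * x, s - t * b)\<close> with \<open>t \<ge> 0\<close> and \<open>s \<ge> c * norm y\<close>.  The hypothesis is the compatibility
  condition of \<open>mazur_orlicz\<close> at \<open>t = 1\<close>, and the case \<open>t > 0\<close> follows by homogeneity.\<close>

lemma exists_dual_bounded_on_subspace:
  fixes Y :: "'a::complex_normed_vector set"
  assumes Y: "complex_vector.subspace Y" and c: "0 \<le> c"
    and b: "\<And>y. y \<in> Y \<Longrightarrow> b \<le> norm (x - y) + c * norm y"
  obtains f where "f \<in> topological_dual" and "\<And>z. cmod (f z) \<le> norm z"
    and "\<And>y. y \<in> Y \<Longrightarrow> cmod (f y) \<le> c * norm y" and "b \<le> Re (f x)"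
proof -
  have Y0: "0 \<in> Y" and Yadd: "\<And>y z. y \<in> Y \<Longrightarrow> z \<in> Y \<Longrightarrow> y + z \<in> Y"
    and YscaleC: "\<And>a y. y \<in> Y \<Longrightarrow> a *\<^sub>C y \<in> Y"
    using Y by (auto simp: complex_vector.subspace_def)
  have Yscale: "\<And>r y. y \<in> Y \<Longrightarrow> r *\<^sub>R y \<in> Y" using YscaleC by (simp add: scaleR_scaleC)
  define K where "K = {(y - t *\<^sub>R x, s - t * b) | y s t. y \<in> Y \<and> 0 \<le> t \<and> c * norm y \<le> s}"
  have KI: "(y - t *\<^sub>R x, s - t * b) \<in> K" if "y \<in> Y" "0 \<le> t" "c * norm y \<le> s" for y s t
    using that by (auto simp: K_def)
  have "convex_cone K"
    unfolding convex_cone_iff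
  proof (intro conjI ballI allI impI)
    show "0 \<in> K" using KI[OF Y0, of 0 0] by (simp add: zero_prod_def)
  next
    fix k l assume "k \<in> K" "l \<in> K"
    then obtain y s t y' s' t' where *: "k = (y - t *\<^sub>R x, s - t * b)" "l = (y' - t' *\<^sub>R x, s' - t' * b)"
      "y \<in> Y" "y' \<in> Y" "0 \<le> t" "0 \<le> t'" "c * norm y \<le> s" "c * norm y' \<le> s'" by (auto simp: K_def)
    have "c * norm (y + y') \<le> s + s'"
      using mult_left_mono[OF norm_triangle_ineq[of y y'] c] *(7,8) by (simp add: algebra_simps)
    then show "k + l \<in> K"
      using KI[of "y + y'" "t + t'" "s + s'"] * Yadd by (simp add: algebra_simps)
  next
    fix k and r :: real assume "k \<in> K" and r: "0 \<le> r"
    then obtain y s t where *: "k = (y - t *\<^sub>R x, s - t * b)" "y \<in> Y" "0 \<le> t" "c * norm y \<le> s"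
      by (auto simp: K_def)
    have "c * norm (r *\<^sub>R y) \<le> r * s"
      using mult_left_mono[OF *(4) r] r by (simp add: mult.left_commute)
    then show "r *\<^sub>R k \<in> K"
      using KI[of "r *\<^sub>R y" "r * t" "r * s"] * r Yscale by (simp add: algebra_simps)
  qed
  moreover have "0 \<le> norm (- y') + s'" if K: "(y', s') \<in> K" for y' s'
  proof -
    obtain y s t where *: "y' = y - t *\<^sub>R x" "s' = s - t * b" "y \<in> Y" "0 \<le> t" "c * norm y \<le> s"
      using K by (auto simp: K_def)
    have "t * b \<le> norm (t *\<^sub>R x - y) + c * norm y"
    proof (cases "t = 0")
      case True
      then show ?thesis using c by simp
    next
      case False
      with *(4) have t: "0 < t" by simp
      have "t * b \<le> t * norm (x - y /\<^sub>R t) + c * (t * norm (y /\<^sub>R t))"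
        using mult_left_mono[OF b[OF Yscale[OF *(3), of "inverse t"]] *(4)] by (simp add: algebra_simps)
      also have "t * norm (x - y /\<^sub>R t) = norm (t *\<^sub>R (x - y /\<^sub>R t))" using t by simp
      also have "t *\<^sub>R (x - y /\<^sub>R t) = t *\<^sub>R x - y" using t by (simp add: scaleR_diff_right)
      also have "t * norm (y /\<^sub>R t) = norm y" using t by simp
      finally show ?thesis .
    qed
    with * show ?thesis by (simp add: norm_minus_commute)
  qed
  ultimately obtain \<phi> where \<phi>: "linear \<phi>" "\<phi> \<le> norm" "\<And>y s. (y, s) \<in> K \<Longrightarrow> \<phi> y \<le> s"
    using mazur_orlicz[OF sublinear_norm] by blast
  obtain f where f: "Vector_Spaces.linear (*\<^sub>C) (*) f" "\<And>z. Re (f z) = \<phi> z"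
    using exists_complex_linear_with_Re[OF \<phi>(1)] by blast
  have norm: "cmod (f z) \<le> norm z" for z
  proof (rule cmod_le_if_Re_rotations_le[OF f(1)])
    fix u assume "cmod u = 1"
    then show "Re (f (u *\<^sub>C z)) \<le> norm z"
      using le_funD[OF \<phi>(2), of "u *\<^sub>C z"] by (simp add: f(2) norm_scaleC)
  qed
  moreover have "cmod (f y) \<le> c * norm y" if "y \<in> Y" for y
  proof (rule cmod_le_if_Re_rotations_le[OF f(1)])
    fix u assume "cmod u = 1"
    then show "Re (f (u *\<^sub>C y)) \<le> c * norm y"
      using \<phi>(3)[OF KI[OF YscaleC[OF that, of u], of 0 "c * norm y"]] by (simp add: f(2) norm_scaleC)
  qed
  moreover have "b \<le> Re (f x)"
    using \<phi>(3)[OF KI[OF Y0, of 1 0]] by (simp add: f(2) linear_neg[OF \<phi>(1)])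
  ultimately show thesis by (intro that) (auto intro: dual_if_bounded[OF f(1)])
qed

lemma exists_dual_vanishing_on_closed_subspace:
  fixes Y :: "'a::complex_normed_vector set"
  assumes Y: "complex_vector.subspace Y" and "closed Y" and "x \<notin> Y"
  obtains g where "g \<in> topological_dual" and "\<And>y. y \<in> Y \<Longrightarrow> g y = 0" and "0 < Re (g x)"
proof -
  have ne: "Y \<noteq> {}" using complex_vector.subspace_0[OF Y] by auto
  have pos: "0 < infdist x Y"
    using assms ne by (metis in_closed_iff_infdist_zero infdist_nonneg less_eq_real_def)
  have "infdist x Y \<le> norm (x - y) + 0 * norm y" if "y \<in> Y" for y
    using infdist_le[OF that, of x] by (simp add: dist_norm)
  then obtain g where "g \<in> topological_dual" "\<And>y. y \<in> Y \<Longrightarrow> cmod (g y) \<le> 0 * norm y"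
    "infdist x Y \<le> Re (g x)"
    using exists_dual_bounded_on_subspace[OF Y order.refl, of "infdist x Y" x] by blast
  with pos show thesis by (intro that[of g]) auto
qed

lemma exists_norm_one_on_ray:
  fixes f g :: "'a::real_normed_vector \<Rightarrow> complex"
  assumes f: "bounded_linear f" and g: "bounded_linear g" and le: "onorm f \<le> 1"
    and fx: "0 \<le> Re (f x)" and gx: "0 < Re (g x)"
  obtains t where "0 \<le> t" and "onorm (\<lambda>z. f z + t *\<^sub>R g z) = 1"
proof -
  define h where "h t = norm (Blinfun f + t *\<^sub>R Blinfun g)" for t
  have h: "h t = onorm (\<lambda>z. f z + t *\<^sub>R g z)" for t
    by (simp add: h_def norm_blinfun.rep_eq plus_blinfun.rep_eq scaleR_blinfun.rep_eq
        bounded_linear_Blinfun_apply f g)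
  have cont: "continuous_on S h" for S unfolding h_def by (intro continuous_intros)
  have x: "0 < norm x" using gx linear_0[OF bounded_linear.linear[OF g]] by force
  define T where "T = norm x / Re (g x)"
  have T: "0 \<le> T" using gx by (simp add: T_def)
  have "norm x \<le> Re (f x + T *\<^sub>R g x)" using fx gx by (simp add: T_def)
  also have "\<dots> \<le> cmod (f x + T *\<^sub>R g x)" by (rule complex_Re_le_cmod)
  also have "\<dots> \<le> h T * norm x"
    unfolding h using f g
    by (intro onorm[of "\<lambda>z. f z + T *\<^sub>R g z"] bounded_linear_add bounded_linear_scaleR_right
        bounded_linear_compose[OF bounded_linear_scaleR_right])
  finally have "1 \<le> h T" using x by simp
  moreover have "h 0 \<le> 1" using le by (simp add: h)
  ultimately obtain t where "0 \<le> t" "h t = 1" using IVT'[of h 0 1 T] T cont by blast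
  then show thesis by (intro that) (auto simp: h)
qed

section \<open>Approximate orthogonality to a subspace\<close>

lemma approx_orthogonal_imp_distance:
  assumes "approx_orthogonal \<delta> \<epsilon> x y"
  shows "(1 - \<delta>) * norm x \<le> norm (x - y) + \<epsilon> / (1 - \<delta>) * norm y"
proof -
  obtain f where f: "f \<in> topological_dual" "f \<noteq> (\<lambda>_. 0)" "(1 - \<delta>) * onorm f * norm x \<le> cmod (f x)"
    "cmod (f y) \<le> \<epsilon> / (1 - \<delta>) * onorm f * norm y"
    using assms by (auto simp: approx_orthogonal_def)
  have bl: "bounded_linear f" using f(1) by (rule dual_imp_bounded_linear)
  have pos: "0 < onorm f" using f(2) by (simp add: onorm_pos_lt[OF bl] fun_eq_iff)
  have "cmod (f x) \<le> cmod (f (x - y)) + cmod (f y)"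
    using norm_triangle_ineq[of "f (x - y)" "f y"]
    by (simp add: linear_diff[OF bounded_linear.linear[OF bl]])
  also have "\<dots> \<le> onorm f * norm (x - y) + \<epsilon> / (1 - \<delta>) * onorm f * norm y"
    using onorm[OF bl, of "x - y"] f(4) by simp
  finally have "onorm f * ((1 - \<delta>) * norm x) \<le> onorm f * (norm (x - y) + \<epsilon> / (1 - \<delta>) * norm y)"
    using f(3) by (simp add: algebra_simps)
  then show ?thesis using pos by simp
qed

theorem theorem1p5:
  fixes Y :: "'a::complex_normed_vector set" and x :: 'a and \<epsilon> \<delta> :: real
  assumes "complex_vector.subspace Y" and "closed Y" and "x \<notin> Y"
    and "\<epsilon> \<in> {0..<1}" and "\<delta> \<in> {0..<1}" and "\<epsilon> < (1 - \<delta>)\<^sup>2"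
  shows "(\<forall>y\<in>Y. approx_orthogonal \<delta> \<epsilon> x y) \<longleftrightarrow>
    (\<exists>f\<in>topological_dual. onorm f = 1 \<and> cmod (f x) \<ge> (1 - \<delta>) * norm x \<and>
       onorm_on Y f \<le> \<epsilon> / (1 - \<delta>))"
proof -
  define c where "c = \<epsilon> / (1 - \<delta>)"
  have c: "0 \<le> c" using assms(4,5) by (simp add: c_def)
  have ne: "Y \<noteq> {}" using assms(1) complex_vector.subspace_0 by blast
  show ?thesis
    unfolding c_def[symmetric]
  proof
    assume "\<forall>y\<in>Y. approx_orthogonal \<delta> \<epsilon> x y"
    then have "(1 - \<delta>) * norm x \<le> norm (x - y) + c * norm y" if "y \<in> Y" for y
      unfolding c_def using approx_orthogonal_imp_distance that by blast
    then obtain f where f: "f \<in> topological_dual" "\<And>z. cmod (f z) \<le> norm z"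
      "\<And>y. y \<in> Y \<Longrightarrow> cmod (f y) \<le> c * norm y" "(1 - \<delta>) * norm x \<le> Re (f x)"
      using exists_dual_bounded_on_subspace[OF assms(1) c] by blast
    obtain g where g: "g \<in> topological_dual" "\<And>y. y \<in> Y \<Longrightarrow> g y = 0" "0 < Re (g x)"
      using exists_dual_vanishing_on_closed_subspace[OF assms(1-3)] by blast
    have "onorm f \<le> 1" using f(2) by (intro onorm_bound) auto
    moreover have "0 \<le> Re (f x)"
      using f(4) assms(5) by (smt (verit) atLeastLessThan_iff mult_nonneg_nonneg norm_ge_zero)
    ultimately obtain t where t: "0 \<le> t" "onorm (\<lambda>z. f z + t *\<^sub>R g z) = 1"
      using exists_norm_one_on_ray[OF dual_imp_bounded_linear dual_imp_bounded_linear] f(1) g(1,3)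
      by blast
    define F where "F = (\<lambda>z. f z + t *\<^sub>R g z)"
    have F: "F \<in> topological_dual" unfolding F_def using f(1) g(1) by (rule dual_add_scaleR)
    have "(1 - \<delta>) * norm x \<le> Re (F x)"
      using f(4) t(1) g(3) by (simp add: F_def add_increasing2)
    then have "(1 - \<delta>) * norm x \<le> cmod (F x)"
      using complex_Re_le_cmod order_trans by blast
    moreover have "onorm_on Y F \<le> c"
      using f(3) g(2) unfolding onorm_on_le_iff[OF F ne c] by (simp add: F_def)
    ultimately show "\<exists>f\<in>topological_dual. onorm f = 1 \<and> cmod (f x) \<ge> (1 - \<delta>) * norm x \<and> onorm_on Y f \<le> c"
      using F t(2) by (auto simp: F_def)
  next
    assume "\<exists>f\<in>topological_dual. onorm f = 1 \<and> cmod (f x) \<ge> (1 - \<delta>) * norm x \<and> onorm_on Y f \<le> c"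
    then obtain f where f: "f \<in> topological_dual" "onorm f = 1" "cmod (f x) \<ge> (1 - \<delta>) * norm x"
      "\<And>y. y \<in> Y \<Longrightarrow> cmod (f y) \<le> c * norm y"
      using onorm_on_le_iff[OF _ ne c] by blast
    moreover have "f \<noteq> (\<lambda>_. 0)" using f(2) by (auto simp: onorm_zero)
    ultimately show "\<forall>y\<in>Y. approx_orthogonal \<delta> \<epsilon> x y"
      unfolding approx_orthogonal_def c_def[symmetric] by (auto intro!: bexI[of _ f])
  qed
qed

end
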